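(* A quasi-metric space is $\mathrm{Sym}$-roughly isometric to a $q$-hyperconvex quasi-metric space if and only if it is $\mathrm{Sym}$-coarsely injective.
   Context: A quasi-metric space is a set $X$ with a map $d\colon X\times X\to[0,\infty)$ such that $d(x,y)\leq d(x,z)+d(z,y)$ for all $x,y,z\in X$, and, for all $x,y\in X$, $d(x,y)=d(y,x)=0$ if and only if $x=y$ (symmetry is not required). Let $d^{-1}(x,y)=d(y,x)$, $d^s(x,y)=\max\{d(x,y),d(y,x)\}$, and $C_d(x,r)=\{y\in X\mid d(x,y)\leq r\}$. A map $\varphi\colon(X,d_X)\to(Y,d_Y)$ between quasi-metric spaces is a $\mathrm{Sym}$-rough isometry if there is $\varepsilon\geq 0$ such that for every $y\in Y$ there is $x\in X$ with $d_Y^s(y,\varphi(x))\leq\varepsilon$, and $d_X(x,x')-\varepsilon\leq d_Y(\varphi(x),\varphi(x'))\leq d_X(x,x')+\varepsilon$ for all $x,x'\in X$. Two quasi-metric spaces are $\mathrm{Sym}$-roughly isometric if there is a $\mathrm{Sym}$-rough isometry between them (this is a symmetric relation). $(X,d)$ is $\mathrm{Sym}$-coarsely injective if there is $\delta\geq 0$ such that, for every family $\{(x_i,r_i,s_i)\}_{i\in I}\subseteq X\times[0,\infty)\times[0,\infty)$ satisfying $d(x_i,x_j)\leq r_i+s_j$ for all $i,j\in I$, one has $\bigcap_{i\in I}\big(C_d(x_i,r_i+\delta)\cap C_{d^{-1}}(x_i,s_i+\delta)\big)\neq\emptyset$ (where the intersection over the empty family is $X$). $(X,d)$ is $q$-hyperconvex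 if this holds with $\delta=0$. *)

theory Defs
  imports Complex_Main "HOL-Library.FuncSet"
begin

locale quasi_metric_space =
  fixes X :: "'a set" and d :: "'a \<Rightarrow> 'a \<Rightarrow> real"
  assumes nonneg: "\<lbrakk>x \<in> X; y \<in> X\<rbrakk> \<Longrightarrow> 0 \<le> d x y"
    and triangle: "\<lbrakk>x \<in> X; y \<in> X; z \<in> X\<rbrakk> \<Longrightarrow> d x y \<le> d x z + d z y"
    and separated: "\<lbrakk>x \<in> X; y \<in> X\<rbrakk> \<Longrightarrow> (d x y = 0 \<and> d y x = 0) \<longleftrightarrow> x = y"

definition conj_dist :: "('a \<Rightarrow> 'a \<Rightarrow> real) \<Rightarrow> 'a \<Rightarrow> 'a \<Rightarrow> real" where
  "conj_dist d x y = d y x"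

definition sym_dist :: "('a \<Rightarrow> 'a \<Rightarrow> real) \<Rightarrow> 'a \<Rightarrow> 'a \<Rightarrow> real" where
  "sym_dist d x y = max (d x y) (d y x)"

definition qcball :: "'a set \<Rightarrow> ('a \<Rightarrow> 'a \<Rightarrow> real) \<Rightarrow> 'a \<Rightarrow> real \<Rightarrow> 'a set" where
  "qcball X d x r = {y \<in> X. d x y \<le> r}"

definition sym_rough_isometry ::
  "'a set \<Rightarrow> ('a \<Rightarrow> 'a \<Rightarrow> real) \<Rightarrow> 'b set \<Rightarrow> ('b \<Rightarrow> 'b \<Rightarrow> real) \<Rightarrow> ('a \<Rightarrow> 'b) \<Rightarrow> bool" where
  "sym_rough_isometry X dX Y dY \<phi> \<longleftrightarrow>
     \<phi> \<in> X \<rightarrow> Y \<and>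
     (\<exists>\<epsilon>\<ge>0.
        (\<forall>y\<in>Y. \<exists>x\<in>X. sym_dist dY y (\<phi> x) \<le> \<epsilon>) \<and>
        (\<forall>x\<in>X. \<forall>x'\<in>X. dX x x' - \<epsilon> \<le> dY (\<phi> x) (\<phi> x') \<and>
                        dY (\<phi> x) (\<phi> x') \<le> dX x x' + \<epsilon>))"

definition sym_roughly_isometric ::
  "'a set \<Rightarrow> ('a \<Rightarrow> 'a \<Rightarrow> real) \<Rightarrow> 'b set \<Rightarrow> ('b \<Rightarrow> 'b \<Rightarrow> real) \<Rightarrow> bool" where
  "sym_roughly_isometric X dX Y dY \<longleftrightarrow> (\<exists>\<phi>. sym_rough_isometry X dX Y dY \<phi>)"

text \<open>
  The direction of the map in the previous definition does not matter.
\<close>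

lemma sym_roughly_isometric_sym:
  assumes "quasi_metric_space Y dY" and "sym_roughly_isometric X dX Y dY"
  shows "sym_roughly_isometric Y dY X dX"
proof -
  interpret Y: quasi_metric_space Y dY by fact
  from assms(2) obtain \<phi> \<epsilon> where \<phi>: "\<And>x. x \<in> X \<Longrightarrow> \<phi> x \<in> Y" and \<epsilon>: "\<epsilon> \<ge> 0"
    and dense: "\<And>y. y \<in> Y \<Longrightarrow> \<exists>x\<in>X. sym_dist dY y (\<phi> x) \<le> \<epsilon>"
    and iso: "\<And>x x'. \<lbrakk>x \<in> X; x' \<in> X\<rbrakk> \<Longrightarrow>
                dX x x' - \<epsilon> \<le> dY (\<phi> x) (\<phi> x') \<and> dY (\<phi> x) (\<phi> x') \<le> dX x x' + \<epsilon>"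
    unfolding sym_roughly_isometric_def sym_rough_isometry_def by blast
  from dense obtain \<psi> where \<psi>: "\<And>y. y \<in> Y \<Longrightarrow> \<psi> y \<in> X"
    and close: "\<And>y. y \<in> Y \<Longrightarrow> sym_dist dY y (\<phi> (\<psi> y)) \<le> \<epsilon>"
    by metis
  have close1: "dY y (\<phi> (\<psi> y)) \<le> \<epsilon>" and close2: "dY (\<phi> (\<psi> y)) y \<le> \<epsilon>" if "y \<in> Y" for y
    using close[OF that] by (auto simp: sym_dist_def)
  have dense': "sym_dist dX x (\<psi> (\<phi> x)) \<le> 3 * \<epsilon>" if x: "x \<in> X" for x
    using iso[OF x \<psi>[OF \<phi>[OF x]]] iso[OF \<psi>[OF \<phi>[OF x]] x]
      close1[OF \<phi>[OF x]] close2[OF \<phi>[OF x]] \<epsilon>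
    by (simp add: sym_dist_def)
  have iso': "dY y y' - 3 * \<epsilon> \<le> dX (\<psi> y) (\<psi> y') \<and> dX (\<psi> y) (\<psi> y') \<le> dY y y' + 3 * \<epsilon>"
    if y: "y \<in> Y" and y': "y' \<in> Y" for y y'
  proof -
    let ?p = "\<phi> (\<psi> y)" and ?p' = "\<phi> (\<psi> y')"
    have p: "?p \<in> Y" "?p' \<in> Y" using \<phi> \<psi> y y' by auto
    have "dY y y' \<le> dY y ?p + dY ?p y'" "dY ?p y' \<le> dY ?p ?p' + dY ?p' y'"
      "dY ?p ?p' \<le> dY ?p y + dY y ?p'" "dY y ?p' \<le> dY y y' + dY y' ?p'"
      using Y.triangle y y' p by blast+
    then show ?thesis
      using iso[OF \<psi>[OF y] \<psi>[OF y']] close1[OF y] close2[OF y] close1[OF y'] close2[OF y']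
      by linarith
  qed
  have "sym_rough_isometry Y dY X dX \<psi>"
    unfolding sym_rough_isometry_def
    using \<psi> \<phi> \<epsilon> dense' iso' by (intro conjI exI[of _ "3 * \<epsilon>"]) auto
  then show ?thesis
    unfolding sym_roughly_isometric_def by blast
qed

text \<open>
  A family of triples enters the following condition only through its range, so it is given
  as a set \<open>F\<close> of triples.  The intersection with \<open>X\<close> matters only for empty
  \<open>F\<close>, where it says that the empty intersection is \<open>X\<close>; in particular, \<open>X\<close>
  must be nonempty.
\<close>

definition sym_ball_intersection :: "'a set \<Rightarrow> ('a \<Rightarrow> 'a \<Rightarrow> real) \<Rightarrow> real \<Rightarrow> bool" where
  "sym_ball_intersection X d \<delta> \<longleftrightarrow>
     (\<forall>F \<subseteq> X \<times> {0..} \<times> {0..}.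
        (\<forall>(x, r, s) \<in> F. \<forall>(x', r', s') \<in> F. d x x' \<le> r + s') \<longrightarrow>
        X \<inter> (\<Inter>(x, r, s) \<in> F. qcball X d x (r + \<delta>) \<inter> qcball X (conj_dist d) x (s + \<delta>)) \<noteq> {})"

definition sym_coarsely_injective :: "'a set \<Rightarrow> ('a \<Rightarrow> 'a \<Rightarrow> real) \<Rightarrow> bool" where
  "sym_coarsely_injective X d \<longleftrightarrow> (\<exists>\<delta>\<ge>0. sym_ball_intersection X d \<delta>)"

definition q_hyperconvex :: "'a set \<Rightarrow> ('a \<Rightarrow> 'a \<Rightarrow> real) \<Rightarrow> bool" where
  "q_hyperconvex X d \<longleftrightarrow> sym_ball_intersection X d 0"

end

theory Submission
  imports Defs
begin

text \<open>
  Transporting a family of balls along a rough isometry costs a fixed multiple of its constant, so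
  a space roughly isometric to a \<open>q\<close>-hyperconvex one is coarsely injective
  (\<open>coarsely_injective_if_roughly_isometric\<close>).

  Conversely, every nonempty quasi-metric space \<open>X\<close> sits isometrically in its \<open>q\<close>-hyperconvex hull, and
  coarse injectivity says precisely that \<open>X\<close> is coarsely dense there.  A point \<open>p\<close> of a space
  containing \<open>X\<close> is seen from \<open>X\<close> as the pair of functions \<open>r = d(\<cdot>,p)\<close>, \<open>s = d(p,\<cdot>)\<close>, and the
  triangle inequality becomes \<open>d x y \<le> r x + s y\<close>.  The hull consists of the pairs of nonnegative
  functions that are minimal under this constraint.

  If \<open>(r, s)\<close> is such a pair, then the triples \<open>(x, r x, s x)\<close> form an admissible family of balls
  in \<open>X\<close>.  A point \<open>z\<close> provided by coarse injectivity satisfies \<open>d x z \<le> r x + \<delta>\<close> and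
  \<open>d z x \<le> s x + \<delta>\<close>, and by minimality this already places \<open>z\<close> within \<open>\<delta>\<close> of \<open>(r, s)\<close> in both
  directions (\<open>hull_embedding_dense\<close>).

  The hull is \<open>q\<close>-hyperconvex (\<open>q_hyperconvex_hull\<close>) because the pointwise infimum of the upper
  bounds that a family of balls prescribes again satisfies the constraint; a minimal pair below it
  lies in all the balls, the lower bounds being implied by the upper ones through minimality.
  Minimal pairs are obtained explicitly: replace first \<open>r\<close> and then \<open>s\<close> by the least function
  admissible for the other one.  Passing to the least partner is an antitone Galois connection, so
  the procedure stabilises after these two steps (\<open>minimal_pair_below\<close>).
\<close>

section \<open>Families of balls and rough isometries\<close>

lemma sym_ball_intersection_iff:
  "sym_ball_intersection X d \<delta> \<longleftrightarrow>
     (\<forall>F \<subseteq> X \<times> {0..} \<times> {0..}.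
        (\<forall>(x, r, s) \<in> F. \<forall>(x', r', s') \<in> F. d x x' \<le> r + s') \<longrightarrow>
        (\<exists>z\<in>X. \<forall>(x, r, s) \<in> F. d x z \<le> r + \<delta> \<and> d z x \<le> s + \<delta>))"
proof -
  have "X \<inter> (\<Inter>(x, r, s) \<in> F. qcball X d x (r + \<delta>) \<inter> qcball X (conj_dist d) x (s + \<delta>)) \<noteq> {}
    \<longleftrightarrow> (\<exists>z\<in>X. \<forall>(x, r, s) \<in> F. d x z \<le> r + \<delta> \<and> d z x \<le> s + \<delta>)" for F
    by (fastforce simp: qcball_def conj_dist_def)
  then show ?thesis
    unfolding sym_ball_intersection_def by presburger
qed

lemma sym_ball_intersection_point:
  assumes "sym_ball_intersection X d \<delta>" and "F \<subseteq> X \<times> {0..} \<times> {0..}"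
    and "\<forall>(x, r, s) \<in> F. \<forall>(x', r', s') \<in> F. d x x' \<le> r + s'"
  shows "\<exists>z\<in>X. \<forall>(x, r, s) \<in> F. d x z \<le> r + \<delta> \<and> d z x \<le> s + \<delta>"
  using assms(1)[unfolded sym_ball_intersection_iff, rule_format, OF assms(2)] assms(3) by simp

lemma coarsely_injective_nonempty:
  assumes "sym_coarsely_injective X d"
  shows "X \<noteq> {}"
proof -
  obtain \<delta> where "sym_ball_intersection X d \<delta>"
    using assms unfolding sym_coarsely_injective_def by blast
  from sym_ball_intersection_point[OF this, of "{}"] show ?thesis by auto
qed

text \<open>
  Push the balls forward to \<open>Y\<close>, enlarged by \<open>\<epsilon>\<close> to stay admissible, and approximate a common
  point by the image of a point of \<open>X\<close>.  The constant \<open>3\<epsilon>\<close> is one \<open>\<epsilon>\<close> for the enlargement, one for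
  the approximation, and one for comparing distances back in \<open>X\<close>.
\<close>

lemma coarsely_injective_if_roughly_isometric:
  assumes "quasi_metric_space Y dY" and hyp: "q_hyperconvex Y dY"
    and "sym_roughly_isometric X d Y dY"
  shows "sym_coarsely_injective X d"
proof -
  interpret Y: quasi_metric_space Y dY by fact
  obtain \<phi> \<epsilon> where \<phi>: "\<And>x. x \<in> X \<Longrightarrow> \<phi> x \<in> Y" and \<epsilon>: "\<epsilon> \<ge> 0"
    and dense: "\<And>y. y \<in> Y \<Longrightarrow> \<exists>x\<in>X. sym_dist dY y (\<phi> x) \<le> \<epsilon>"
    and lower: "\<And>x x'. \<lbrakk>x \<in> X; x' \<in> X\<rbrakk> \<Longrightarrow> d x x' - \<epsilon> \<le> dY (\<phi> x) (\<phi> x')"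
    and upper: "\<And>x x'. \<lbrakk>x \<in> X; x' \<in> X\<rbrakk> \<Longrightarrow> dY (\<phi> x) (\<phi> x') \<le> d x x' + \<epsilon>"
    using assms(3) unfolding sym_roughly_isometric_def sym_rough_isometry_def by blast
  have "\<exists>z\<in>X. \<forall>(x, r, s) \<in> F. d x z \<le> r + 3 * \<epsilon> \<and> d z x \<le> s + 3 * \<epsilon>"
    if F: "F \<subseteq> X \<times> {0..} \<times> {0..}"
      and adm: "\<forall>(x, r, s) \<in> F. \<forall>(x', r', s') \<in> F. d x x' \<le> r + s'" for F
  proof -
    define G where "G = (\<lambda>(x, r, s). (\<phi> x, r + \<epsilon>, s + \<epsilon>)) ` F"
    have "G \<subseteq> Y \<times> {0..} \<times> {0..}"
      using F \<phi> \<epsilon> unfolding G_def by fastforce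
    moreover have "\<forall>(y, r, s) \<in> G. \<forall>(y', r', s') \<in> G. dY y y' \<le> r + s'"
    proof -
      have "dY (\<phi> x) (\<phi> x') \<le> (r + \<epsilon>) + (s' + \<epsilon>)" if "(x, r, s) \<in> F" "(x', r', s') \<in> F"
        for x r s x' r' s'
      proof -
        have "d x x' \<le> r + s'" "x \<in> X" "x' \<in> X" using that adm F by blast+
        then show ?thesis using upper[of x x'] \<epsilon> by linarith
      qed
      then show ?thesis by (auto simp: G_def)
    qed
    ultimately have "\<exists>y\<in>Y. \<forall>(y', r, s) \<in> G. dY y' y \<le> r + 0 \<and> dY y y' \<le> s + 0"
      by (rule sym_ball_intersection_point[OF hyp[unfolded q_hyperconvex_def]])
    then obtain y where y: "y \<in> Y" and yG: "\<forall>(y', r, s) \<in> G. dY y' y \<le> r \<and> dY y y' \<le> s"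
      unfolding add_0_right by blast
    obtain z where z: "z \<in> X" "dY y (\<phi> z) \<le> \<epsilon>" "dY (\<phi> z) y \<le> \<epsilon>"
      using dense[OF y] by (auto simp: sym_dist_def)
    have "d x z \<le> r + 3 * \<epsilon> \<and> d z x \<le> s + 3 * \<epsilon>" if xF: "(x, r, s) \<in> F" for x r s
    proof -
      have x: "x \<in> X" using F xF by blast
      have "(\<phi> x, r + \<epsilon>, s + \<epsilon>) \<in> G" using xF unfolding G_def by force
      then have "dY (\<phi> x) y \<le> r + \<epsilon>" "dY y (\<phi> x) \<le> s + \<epsilon>" using yG by blast+
      moreover have "dY (\<phi> x) (\<phi> z) \<le> dY (\<phi> x) y + dY y (\<phi> z)"
        "dY (\<phi> z) (\<phi> x) \<le> dY (\<phi> z) y + dY y (\<phi> x)"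
        using Y.triangle \<phi> x z(1) y by blast+
      ultimately show ?thesis using lower[OF x z(1)] lower[OF z(1) x] z(2,3) by linarith
    qed
    then show ?thesis using z(1) by blast
  qed
  then have "sym_ball_intersection X d (3 * \<epsilon>)"
    unfolding sym_ball_intersection_iff by blast
  then show ?thesis using \<epsilon> unfolding sym_coarsely_injective_def by (intro exI[of _ "3 * \<epsilon>"]) simp
qed

section \<open>Minimal pairs\<close>

text \<open>
  Without nonnegativity the hull would be too large: for a one-point space, all pairs
  \<open>(t, - t)\<close> of constants would be minimal, and they form a whole line.
\<close>

definition ample_pair :: "'a set \<Rightarrow> ('a \<Rightarrow> 'a \<Rightarrow> real) \<Rightarrow> ('a \<Rightarrow> real) \<times> ('a \<Rightarrow> real) \<Rightarrow> bool" where
  "ample_pair X d f \<longleftrightarrow> (\<forall>x\<in>X. 0 \<le> fst f x \<and> 0 \<le> snd f x) \<and>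
     (\<forall>x\<in>X. \<forall>y\<in>X. d x y \<le> fst f x + snd f y)"

text \<open>
  These are the ample pairs that are minimal for the pointwise order, with minimality expressed by
  the universal property of the suprema \<open>fst f x = sup {0, d x y - snd f y | y}\<close> and
  \<open>snd f y = sup {0, d x y - fst f x | x}\<close>.  Fixing the values outside \<open>X\<close> makes the distance
  defined below separate points.
\<close>

definition hyperconvex_hull :: "'a set \<Rightarrow> ('a \<Rightarrow> 'a \<Rightarrow> real) \<Rightarrow> (('a \<Rightarrow> real) \<times> ('a \<Rightarrow> real)) set" where
  "hyperconvex_hull X d = {f. ample_pair X d f \<and>
     (\<forall>x\<in>X. \<forall>c\<ge>0. (\<forall>y\<in>X. d x y \<le> c + snd f y) \<longrightarrow> fst f x \<le> c) \<and>
     (\<forall>y\<in>X. \<forall>c\<ge>0. (\<forall>x\<in>X. d x y \<le> fst f x + c) \<longrightarrow> snd f y \<le> c) \<and>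
     fst f \<in> extensional X \<and> snd f \<in> extensional X}"

lemma hull_nonneg:
  assumes "f \<in> hyperconvex_hull X d" "x \<in> X"
  shows "0 \<le> fst f x" "0 \<le> snd f x"
  using assms by (auto simp: hyperconvex_hull_def ample_pair_def)

lemma hull_ample:
  assumes "f \<in> hyperconvex_hull X d" "x \<in> X" "y \<in> X"
  shows "d x y \<le> fst f x + snd f y"
  using assms by (auto simp: hyperconvex_hull_def ample_pair_def)

lemma hull_fst_least:
  assumes "f \<in> hyperconvex_hull X d" "x \<in> X" "0 \<le> c" "\<And>y. y \<in> X \<Longrightarrow> d x y \<le> c + snd f y"
  shows "fst f x \<le> c"
  using assms by (auto simp: hyperconvex_hull_def)

lemma hull_snd_least:
  assumes "f \<in> hyperconvex_hull X d" "y \<in> X" "0 \<le> c" "\<And>x. x \<in> X \<Longrightarrow> d x y \<le> fst f x + c"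
  shows "snd f y \<le> c"
  using assms by (auto simp: hyperconvex_hull_def)

text \<open>
  Let \<open>r\<close> be the least function ample with \<open>snd g\<close>, and \<open>s\<close> the least function ample with \<open>r\<close>.
  Then \<open>s \<le> snd g\<close>, so the least partner of \<open>s\<close> is at least that of \<open>snd g\<close>, which is \<open>r\<close>; as
  \<open>r\<close> is ample with \<open>s\<close>, it is exactly \<open>r\<close>.
\<close>

lemma minimal_pair_below:
  assumes g: "ample_pair X d g"
  obtains h where "h \<in> hyperconvex_hull X d"
    and "\<And>x. x \<in> X \<Longrightarrow> fst h x \<le> fst g x" and "\<And>x. x \<in> X \<Longrightarrow> snd h x \<le> snd g x"
proof -
  have g0: "0 \<le> fst g x" "0 \<le> snd g x" if "x \<in> X" for x
    using g that by (auto simp: ample_pair_def)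
  have ga: "d x y \<le> fst g x + snd g y" if "x \<in> X" "y \<in> X" for x y
    using g that by (auto simp: ample_pair_def)
  define r where "r = restrict (\<lambda>x. SUP y\<in>X. max 0 (d x y - snd g y)) X"
  have r_upper: "max 0 (d x y - snd g y) \<le> r x" if "x \<in> X" "y \<in> X" for x y
  proof -
    have "bdd_above ((\<lambda>y. max 0 (d x y - snd g y)) ` X)"
      using ga[OF that(1)] g0(1)[OF that(1)]
      by (intro bdd_aboveI2[where M = "fst g x"]) (simp add: algebra_simps)
    from cSUP_upper[OF that(2) this] show ?thesis
      using that(1) by (simp add: r_def del: max.bounded_iff)
  qed
  have r_least: "r x \<le> c" if "x \<in> X" "0 \<le> c" "\<And>y. y \<in> X \<Longrightarrow> d x y \<le> c + snd g y" for x c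
  proof -
    have "(SUP y\<in>X. max 0 (d x y - snd g y)) \<le> c"
      using that by (intro cSUP_least) (auto simp: algebra_simps)
    then show ?thesis using that(1) by (simp add: r_def)
  qed
  have r_le: "r x \<le> fst g x" if "x \<in> X" for x
    using r_least that g0 ga by blast
  have r0: "0 \<le> r x" if "x \<in> X" for x
    using r_upper[OF that that] by simp
  have r_ample: "d x y \<le> r x + snd g y" if "x \<in> X" "y \<in> X" for x y
    using r_upper[OF that] by linarith
  define s where "s = restrict (\<lambda>y. SUP x\<in>X. max 0 (d x y - r x)) X"
  have s_upper: "max 0 (d x y - r x) \<le> s y" if "x \<in> X" "y \<in> X" for x y
  proof -
    have "bdd_above ((\<lambda>x. max 0 (d x y - r x)) ` X)"
      using r_ample[OF _ that(2)] g0(2)[OF that(2)]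
      by (intro bdd_aboveI2[where M = "snd g y"]) (simp add: algebra_simps)
    from cSUP_upper[OF that(1) this] show ?thesis
      using that(2) by (simp add: s_def del: max.bounded_iff)
  qed
  have s_least: "s y \<le> c" if "y \<in> X" "0 \<le> c" "\<And>x. x \<in> X \<Longrightarrow> d x y \<le> r x + c" for y c
  proof -
    have "(SUP x\<in>X. max 0 (d x y - r x)) \<le> c"
      using that by (intro cSUP_least) (auto simp: algebra_simps)
    then show ?thesis using that(1) by (simp add: s_def)
  qed
  have s_le: "s y \<le> snd g y" if "y \<in> X" for y
    using s_least that g0 r_ample by blast
  have s0: "0 \<le> s y" if "y \<in> X" for y
    using s_upper[OF that that] by simp
  have s_ample: "d x y \<le> r x + s y" if "x \<in> X" "y \<in> X" for x y
    using s_upper[OF that] by linarith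
  have r_least': "r x \<le> c" if "x \<in> X" "0 \<le> c" "\<forall>y\<in>X. d x y \<le> c + s y" for x c
    using that s_le by (intro r_least) (auto intro: order_trans)
  have "(r, s) \<in> hyperconvex_hull X d"
    using r0 s0 s_ample r_least' s_least by (simp add: hyperconvex_hull_def ample_pair_def r_def s_def)
  then show ?thesis using that r_le s_le by fastforce
qed

section \<open>The hyperconvex hull\<close>

text \<open>
  Comparing first components measures the distance as seen from the points of \<open>X\<close>; the cut-off at
  \<open>0\<close> is the natural asymmetric distance on the line.
\<close>

definition hull_dist ::
  "'a set \<Rightarrow> ('a \<Rightarrow> real) \<times> ('a \<Rightarrow> real) \<Rightarrow> ('a \<Rightarrow> real) \<times> ('a \<Rightarrow> real) \<Rightarrow> real" where
  "hull_dist X f g = (SUP x\<in>X. max 0 (fst g x - fst f x))"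

text \<open>Minimality makes the second components an equivalent, order-reversed record of the distance.\<close>

lemma hull_fst_le_iff_snd_le:
  assumes f: "f \<in> hyperconvex_hull X d" and g: "g \<in> hyperconvex_hull X d" and c: "0 \<le> c"
  shows "(\<forall>x\<in>X. fst g x \<le> fst f x + c) \<longleftrightarrow> (\<forall>x\<in>X. snd f x \<le> snd g x + c)"
proof
  assume le: "\<forall>x\<in>X. fst g x \<le> fst f x + c"
  show "\<forall>x\<in>X. snd f x \<le> snd g x + c"
  proof
    fix y assume y: "y \<in> X"
    show "snd f y \<le> snd g y + c"
    proof (rule hull_snd_least[OF f y])
      show "0 \<le> snd g y + c" using hull_nonneg[OF g y] c by simp
      show "d x y \<le> fst f x + (snd g y + c)" if "x \<in> X" for x
        using hull_ample[OF g that y] le that by force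
    qed
  qed
next
  assume le: "\<forall>x\<in>X. snd f x \<le> snd g x + c"
  show "\<forall>x\<in>X. fst g x \<le> fst f x + c"
  proof
    fix x assume x: "x \<in> X"
    show "fst g x \<le> fst f x + c"
    proof (rule hull_fst_least[OF g x])
      show "0 \<le> fst f x + c" using hull_nonneg[OF f x] c by simp
      show "d x y \<le> fst f x + c + snd g y" if "y \<in> X" for y
        using hull_ample[OF f x that] le that by force
    qed
  qed
qed

text \<open>
  The supremum is finite: first components of minimal pairs are Lipschitz, so comparing with any
  fixed \<open>a \<in> X\<close> bounds \<open>fst g x - fst f x\<close> by \<open>fst g a + snd f a\<close>.
\<close>

lemma hull_dist_bdd:
  assumes "quasi_metric_space X d" and f: "f \<in> hyperconvex_hull X d" and g: "g \<in> hyperconvex_hull X d"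
  shows "bdd_above ((\<lambda>x. max 0 (fst g x - fst f x)) ` X)"
proof (cases "X = {}")
  case False
  interpret quasi_metric_space X d by fact
  obtain a where a: "a \<in> X" using False by blast
  show ?thesis
  proof (rule bdd_aboveI2[where M = "fst g a + snd f a"])
    fix x assume x: "x \<in> X"
    have "fst g x \<le> d x a + fst g a"
    proof (rule hull_fst_least[OF g x])
      show "0 \<le> d x a + fst g a" using nonneg[OF x a] hull_nonneg[OF g a] by simp
      show "d x y \<le> d x a + fst g a + snd g y" if "y \<in> X" for y
        using triangle[OF x that a] hull_ample[OF g a that] by linarith
    qed
    then show "max 0 (fst g x - fst f x) \<le> fst g a + snd f a"
      using hull_ample[OF f x a] hull_nonneg[OF g a] hull_nonneg[OF f a] by simp
  qed
qed simp

lemma hull_dist_le_iff: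
  assumes "quasi_metric_space X d" "X \<noteq> {}" "f \<in> hyperconvex_hull X d" "g \<in> hyperconvex_hull X d" and c: "0 \<le> c"
  shows "hull_dist X f g \<le> c \<longleftrightarrow> (\<forall>x\<in>X. fst g x \<le> fst f x + c)"
  unfolding hull_dist_def cSUP_le_iff[OF assms(2) hull_dist_bdd[OF assms(1,3,4)]]
  using c by (auto simp: algebra_simps)

lemma hull_dist_nonneg:
  assumes "quasi_metric_space X d" "X \<noteq> {}" "f \<in> hyperconvex_hull X d" "g \<in> hyperconvex_hull X d"
  shows "0 \<le> hull_dist X f g"
proof -
  obtain a where "a \<in> X" using assms(2) by blast
  then show ?thesis
    unfolding hull_dist_def using hull_dist_bdd[OF assms(1,3,4)] by (intro cSUP_upper2) auto
qed

lemma hull_dist_upper: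
  assumes "quasi_metric_space X d" "X \<noteq> {}" "f \<in> hyperconvex_hull X d" "g \<in> hyperconvex_hull X d" "x \<in> X"
  shows "fst g x \<le> fst f x + hull_dist X f g"
  using hull_dist_le_iff[OF assms(1-4) hull_dist_nonneg[OF assms(1-4)]] assms(5) by simp

lemma quasi_metric_space_hull:
  assumes X: "quasi_metric_space X d" "X \<noteq> {}"
  shows "quasi_metric_space (hyperconvex_hull X d) (hull_dist X)"
proof
  fix f g assume fg: "f \<in> hyperconvex_hull X d" "g \<in> hyperconvex_hull X d"
  show "0 \<le> hull_dist X f g" using hull_dist_nonneg[OF X fg] .
  show "(hull_dist X f g = 0 \<and> hull_dist X g f = 0) \<longleftrightarrow> f = g"
  proof
    assume "hull_dist X f g = 0 \<and> hull_dist X g f = 0"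
    then have le: "\<forall>x\<in>X. fst g x \<le> fst f x + 0" "\<forall>x\<in>X. fst f x \<le> fst g x + 0"
      using hull_dist_le_iff[OF X fg, of 0] hull_dist_le_iff[OF X fg(2,1), of 0] by simp_all
    have "\<forall>x\<in>X. snd f x \<le> snd g x + 0" "\<forall>x\<in>X. snd g x \<le> snd f x + 0"
      using le hull_fst_le_iff_snd_le[OF fg, of 0] hull_fst_le_iff_snd_le[OF fg(2,1), of 0] by simp_all
    with le have "fst f x = fst g x" "snd f x = snd g x" if "x \<in> X" for x
      using that by (simp_all add: order_antisym)
    moreover have "fst f \<in> extensional X" "fst g \<in> extensional X"
      "snd f \<in> extensional X" "snd g \<in> extensional X"
      using fg by (auto simp: hyperconvex_hull_def)
    ultimately show "f = g" by (intro prod_eqI extensionalityI) auto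
  next
    assume "f = g"
    then show "hull_dist X f g = 0 \<and> hull_dist X g f = 0"
      using X(2) by (simp add: hull_dist_def)
  qed
next
  fix f g h assume f: "f \<in> hyperconvex_hull X d" and g: "g \<in> hyperconvex_hull X d" and h: "h \<in> hyperconvex_hull X d"
  have "fst g x \<le> fst f x + (hull_dist X f h + hull_dist X h g)" if "x \<in> X" for x
    using hull_dist_upper[OF X f h that] hull_dist_upper[OF X h g that] by linarith
  then show "hull_dist X f g \<le> hull_dist X f h + hull_dist X h g"
    using hull_dist_le_iff[OF X f g] hull_dist_nonneg[OF X f h] hull_dist_nonneg[OF X h g] by simp
qed

text \<open>
  A point in all the balls must have first component at most \<open>fst f + \<rho>\<close> and second component at
  most \<open>snd f + \<sigma>\<close>, for every \<open>(f, \<rho>, \<sigma>)\<close> in the family.  The infima of these bounds form an ample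
  pair precisely because the family is admissible, and any minimal pair below it works.
\<close>

lemma q_hyperconvex_hull:
  assumes X: "quasi_metric_space X d" "X \<noteq> {}" and ne: "hyperconvex_hull X d \<noteq> {}"
  shows "q_hyperconvex (hyperconvex_hull X d) (hull_dist X)"
  unfolding q_hyperconvex_def sym_ball_intersection_iff
proof (intro allI impI)
  fix F :: "((('a \<Rightarrow> real) \<times> ('a \<Rightarrow> real)) \<times> real \<times> real) set"
  assume F: "F \<subseteq> hyperconvex_hull X d \<times> {0..} \<times> {0..}"
    and adm: "\<forall>(f, \<rho>, \<sigma>) \<in> F. \<forall>(f', \<rho>', \<sigma>') \<in> F. hull_dist X f f' \<le> \<rho> + \<sigma>'"
  show "\<exists>h\<in>hyperconvex_hull X d. \<forall>(f, \<rho>, \<sigma>) \<in> F. hull_dist X f h \<le> \<rho> + 0 \<and> hull_dist X h f \<le> \<sigma> + 0"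
  proof (cases "F = {}")
    case True
    then show ?thesis using ne by blast
  next
    case False
    have FD: "f \<in> hyperconvex_hull X d" "0 \<le> \<rho>" "0 \<le> \<sigma>" if "(f, \<rho>, \<sigma>) \<in> F" for f \<rho> \<sigma>
      using F that by auto
    define U :: "'a \<Rightarrow> (('a \<Rightarrow> real) \<times> ('a \<Rightarrow> real)) \<times> real \<times> real \<Rightarrow> real"
      where "U = (\<lambda>x (f, \<rho>, \<sigma>). fst f x + \<rho>)"
    define V :: "'a \<Rightarrow> (('a \<Rightarrow> real) \<times> ('a \<Rightarrow> real)) \<times> real \<times> real \<Rightarrow> real"
      where "V = (\<lambda>x (f, \<rho>, \<sigma>). snd f x + \<sigma>)"
    define g where "g = (\<lambda>x. INF t\<in>F. U x t, \<lambda>x. INF t\<in>F. V x t)"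
    have U0: "0 \<le> U x t" and V0: "0 \<le> V x t" if "x \<in> X" "t \<in> F" for x t
    proof -
      obtain f \<rho> \<sigma> where t: "t = (f, \<rho>, \<sigma>)" by (cases t) auto
      show "0 \<le> U x t" "0 \<le> V x t"
        using FD[OF that(2)[unfolded t]] hull_nonneg[of f X d x] that(1)
        by (auto simp: t U_def V_def)
    qed
    have bU: "bdd_below (U x ` F)" and bV: "bdd_below (V x ` F)" if "x \<in> X" for x
      using U0 V0 that by (auto intro!: bdd_belowI2[where m = 0])
    have UV: "d x y \<le> U x t + V y u" if xy: "x \<in> X" "y \<in> X" and tu: "t \<in> F" "u \<in> F" for x y t u
    proof -
      obtain f \<rho> \<sigma> f' \<rho>' \<sigma>' where t: "t = (f, \<rho>, \<sigma>)" and u: "u = (f', \<rho>', \<sigma>')"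
        by (cases t, cases u) auto
      have f: "f \<in> hyperconvex_hull X d" and f': "f' \<in> hyperconvex_hull X d" using FD tu t u by blast+
      have "hull_dist X f f' \<le> \<rho> + \<sigma>'" using adm tu t u by blast
      moreover have "fst f' x \<le> fst f x + hull_dist X f f'"
        using hull_dist_upper[OF X f f' xy(1)] .
      ultimately show ?thesis
        using hull_ample[OF f' xy] by (simp add: U_def V_def t u)
    qed
    have "d x y \<le> fst g x + snd g y" if xy: "x \<in> X" "y \<in> X" for x y
    proof -
      have "d x y - U x t \<le> snd g y" if "t \<in> F" for t
        unfolding g_def snd_conv
        using UV[OF xy that] by (intro cINF_greatest[OF False]) (simp add: algebra_simps)
      then have "d x y - snd g y \<le> fst g x"
        unfolding g_def fst_conv by (intro cINF_greatest[OF False]) (simp add: algebra_simps)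
      then show ?thesis by simp
    qed
    moreover have "0 \<le> fst g x" "0 \<le> snd g x" if "x \<in> X" for x
      using U0 V0 that unfolding g_def fst_conv snd_conv by (auto intro!: cINF_greatest[OF False])
    ultimately have "ample_pair X d g" unfolding ample_pair_def by blast
    then obtain h where h: "h \<in> hyperconvex_hull X d" and hg: "\<And>x. x \<in> X \<Longrightarrow> fst h x \<le> fst g x"
      "\<And>x. x \<in> X \<Longrightarrow> snd h x \<le> snd g x"
      by (rule minimal_pair_below) blast
    have hU: "fst h x \<le> U x t" and hV: "snd h x \<le> V x t" if "x \<in> X" "t \<in> F" for x t
    proof -
      show "fst h x \<le> U x t"
        using hg(1)[OF that(1)] cINF_lower[OF bU[OF that(1)] that(2)] by (simp add: g_def)
      show "snd h x \<le> V x t"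
        using hg(2)[OF that(1)] cINF_lower[OF bV[OF that(1)] that(2)] by (simp add: g_def)
    qed
    have "hull_dist X f h \<le> \<rho> + 0 \<and> hull_dist X h f \<le> \<sigma> + 0" if t: "(f, \<rho>, \<sigma>) \<in> F" for f \<rho> \<sigma>
    proof
      note FD = FD[OF t]
      have "\<forall>x\<in>X. fst h x \<le> fst f x + \<rho>" using hU[OF _ t] by (simp add: U_def)
      then show "hull_dist X f h \<le> \<rho> + 0" using hull_dist_le_iff[OF X FD(1) h FD(2)] by simp
      have "\<forall>x\<in>X. snd h x \<le> snd f x + \<sigma>" using hV[OF _ t] by (simp add: V_def)
      then show "hull_dist X h f \<le> \<sigma> + 0"
        using hull_fst_le_iff_snd_le[OF h FD(1,3)] hull_dist_le_iff[OF X h FD(1,3)] by simp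
    qed
    then show ?thesis using h by blast
  qed
qed

section \<open>The space inside its hull\<close>

definition hull_embedding ::
  "'a set \<Rightarrow> ('a \<Rightarrow> 'a \<Rightarrow> real) \<Rightarrow> 'a \<Rightarrow> ('a \<Rightarrow> real) \<times> ('a \<Rightarrow> real)" where
  "hull_embedding X d z = (restrict (\<lambda>x. d x z) X, restrict (d z) X)"

lemma hull_embedding_in_hull:
  assumes "quasi_metric_space X d" "z \<in> X"
  shows "hull_embedding X d z \<in> hyperconvex_hull X d"
proof -
  interpret quasi_metric_space X d by fact
  have "d z z = 0" using separated assms(2) by blast
  then have "\<forall>x\<in>X. \<forall>c\<ge>0. (\<forall>y\<in>X. d x y \<le> c + d z y) \<longrightarrow> d x z \<le> c"
    "\<forall>y\<in>X. \<forall>c\<ge>0. (\<forall>x\<in>X. d x y \<le> d x z + c) \<longrightarrow> d z y \<le> c"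
    using assms(2) by fastforce+
  then show ?thesis
    using assms(2) nonneg triangle
    by (simp add: hyperconvex_hull_def ample_pair_def hull_embedding_def)
qed

lemma hull_dist_embedding:
  assumes X: "quasi_metric_space X d" and z: "z \<in> X" and w: "w \<in> X"
  shows "hull_dist X (hull_embedding X d z) (hull_embedding X d w) = d z w"
proof -
  interpret quasi_metric_space X d by fact
  have ne: "X \<noteq> {}" using z by blast
  note in_hull = hull_embedding_in_hull[OF X z] hull_embedding_in_hull[OF X w]
  have "d z z = 0" using separated z by blast
  \<comment> \<open>the supremum is attained at \<open>z\<close> itself\<close>
  then have "d z w \<le> hull_dist X (hull_embedding X d z) (hull_embedding X d w)"
    using hull_dist_upper[OF X ne in_hull z] z by (simp add: hull_embedding_def)
  moreover have "hull_dist X (hull_embedding X d z) (hull_embedding X d w) \<le> d z w"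
    using hull_dist_le_iff[OF X ne in_hull nonneg[OF z w]] triangle[OF _ w z]
    by (simp add: hull_embedding_def)
  ultimately show ?thesis by simp
qed

lemma hull_embedding_dense:
  assumes X: "quasi_metric_space X d" and inj: "sym_ball_intersection X d \<delta>" and \<delta>: "0 \<le> \<delta>"
    and f: "f \<in> hyperconvex_hull X d"
  obtains z where "z \<in> X" and "sym_dist (hull_dist X) f (hull_embedding X d z) \<le> \<delta>"
proof -
  define F where "F = (\<lambda>x. (x, fst f x, snd f x)) ` X"
  have "F \<subseteq> X \<times> {0..} \<times> {0..}" using hull_nonneg[OF f] by (auto simp: F_def)
  moreover have "\<forall>(x, r, s) \<in> F. \<forall>(x', r', s') \<in> F. d x x' \<le> r + s'"
    using hull_ample[OF f] by (auto simp: F_def)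
  ultimately obtain z where z: "z \<in> X"
    and zF: "\<forall>(x, r, s) \<in> F. d x z \<le> r + \<delta> \<and> d z x \<le> s + \<delta>"
    using sym_ball_intersection_point[OF inj] by blast
  have le: "d x z \<le> fst f x + \<delta>" "d z x \<le> snd f x + \<delta>" if "x \<in> X" for x
    using zF that by (auto simp: F_def)
  have ne: "X \<noteq> {}" using z by blast
  note e = hull_embedding_in_hull[OF X z]
  have "hull_dist X f (hull_embedding X d z) \<le> \<delta>"
    using hull_dist_le_iff[OF X ne f e \<delta>] le(1) by (simp add: hull_embedding_def)
  moreover have "hull_dist X (hull_embedding X d z) f \<le> \<delta>"
    using hull_dist_le_iff[OF X ne e f \<delta>] hull_fst_le_iff_snd_le[OF e f \<delta>] le(2)
    by (simp add: hull_embedding_def)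
  ultimately show ?thesis using that z by (simp add: sym_dist_def)
qed

lemma roughly_isometric_hull:
  assumes X: "quasi_metric_space X d" and inj: "sym_coarsely_injective X d"
  shows "sym_roughly_isometric X d (hyperconvex_hull X d) (hull_dist X)"
proof -
  obtain \<delta> where \<delta>: "0 \<le> \<delta>" and ball: "sym_ball_intersection X d \<delta>"
    using inj unfolding sym_coarsely_injective_def by blast
  have "\<forall>f\<in>hyperconvex_hull X d. \<exists>z\<in>X. sym_dist (hull_dist X) f (hull_embedding X d z) \<le> \<delta>"
    using hull_embedding_dense[OF X ball \<delta>] by metis
  then have "sym_rough_isometry X d (hyperconvex_hull X d) (hull_dist X) (hull_embedding X d)"
    unfolding sym_rough_isometry_def
    using hull_embedding_in_hull[OF X] hull_dist_embedding[OF X] \<delta>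
    by (intro conjI exI[of _ \<delta>]) auto
  then show ?thesis unfolding sym_roughly_isometric_def by blast
qed

theorem corollary4p11:
  fixes X :: "'a set" and d :: "'a \<Rightarrow> 'a \<Rightarrow> real"
  assumes "quasi_metric_space X d"
  shows "((\<exists>(Y :: (('a \<Rightarrow> real) \<times> ('a \<Rightarrow> real)) set) dY.
              quasi_metric_space Y dY \<and> q_hyperconvex Y dY \<and> sym_roughly_isometric X d Y dY)
           \<longleftrightarrow> sym_coarsely_injective X d)
         \<and> (\<forall>(Y :: 'b set) dY.
              quasi_metric_space Y dY \<and> q_hyperconvex Y dY \<and> sym_roughly_isometric X d Y dY
              \<longrightarrow> sym_coarsely_injective X d)"
proof (intro conjI iffI allI impI)
  assume inj: "sym_coarsely_injective X d"
  have ne: "X \<noteq> {}" using coarsely_injective_nonempty[OF inj] .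
  then have "hyperconvex_hull X d \<noteq> {}" using hull_embedding_in_hull[OF assms] by blast
  then show "\<exists>(Y :: (('a \<Rightarrow> real) \<times> ('a \<Rightarrow> real)) set) dY.
      quasi_metric_space Y dY \<and> q_hyperconvex Y dY \<and> sym_roughly_isometric X d Y dY"
    using quasi_metric_space_hull[OF assms ne] q_hyperconvex_hull[OF assms ne]
      roughly_isometric_hull[OF assms inj] by blast
qed (use coarsely_injective_if_roughly_isometric in blast)+

end
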